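(* For $S_1,S_2\in SL(2,\mathbb{C})$, $S_2$ is conjugate similar to $S_1$ if and only if the real $4\times4$ matrix $R_{S_2}$ is similar to $R_{S_1}$. An arbitrary $S\in SL(2,\mathbb{C})$ belongs to one and only one of the following $3$ types: (1) $S\stackrel{conj}{\sim}\begin{pmatrix} e^u & 0 \\ 0 & e^{-u} \end{pmatrix}$ with $u\geq0$; (2) $S\stackrel{conj}{\sim}\begin{pmatrix} \cos\alpha & \sin\alpha \\ -\sin\alpha & \cos\alpha \end{pmatrix}\stackrel{conj}{\sim}\begin{pmatrix} 0 & i e^{-i\alpha} \\ i e^{i\alpha} & 0 \end{pmatrix}$ with $\alpha\in(0,\frac\pi2]$; (3) $S\stackrel{conj}{\sim}\begin{pmatrix} 1 & 1 \\ 0 & 1 \end{pmatrix}$.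
   Context: For $S_1,S_2\in SL(2,\mathbb{C})$, $S_1$ and $S_2$ are conjugate similar, written $S_1\stackrel{conj}{\sim}S_2$, if there exists $T\in SL(2,\mathbb{C})$ with $S_2=\pm\bar TS_1T^{-1}$, where $\bar T$ is the entrywise complex conjugate. For $S=A+iB\in SL(2,\mathbb{C})$ with $A,B$ real, $R_S:=\begin{pmatrix} A & -B \\ -B & -A \end{pmatrix}$, the real $4\times4$ matrix representing the $\mathbb{R}$-linear map $v\mapsto\overline{Sv}$ of $\mathbb{C}^2$ in the identification $x+iy\leftrightarrow(x,y)$. *)

theory Defs
  imports "HOL-Analysis.Analysis"
begin

definition SL2C :: "(complex^2^2) set" where
  "SL2C = {S. det S = 1}"

definition conj_similar :: "complex^2^2 \<Rightarrow> complex^2^2 \<Rightarrow> bool" where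
  "conj_similar S1 S2 \<longleftrightarrow>
     (\<exists>T\<in>SL2C. S2 = map_matrix cnj T ** S1 ** matrix_inv T \<or>
               S2 = - (map_matrix cnj T ** S1 ** matrix_inv T))"

definition similar_matrix :: "real^'n^'n \<Rightarrow> real^'n^'n \<Rightarrow> bool" where
  "similar_matrix M N \<longleftrightarrow> (\<exists>P. invertible P \<and> N = P ** M ** matrix_inv P)"

definition mat22 :: "'a::zero \<Rightarrow> 'a \<Rightarrow> 'a \<Rightarrow> 'a \<Rightarrow> 'a^2^2" where
  "mat22 a b c d = vector [vector [a, b], vector [c, d]]"

definition R_mat :: "complex^2^2 \<Rightarrow> real^4^4" where
  "R_mat S =
    (let A = (\<lambda>i j. Re (S $ i $ j)); B = (\<lambda>i j. Im (S $ i $ j)) in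
     vector
      [vector [  A 1 1,   A 1 2, - B 1 1, - B 1 2],
       vector [  A 2 1,   A 2 2, - B 2 1, - B 2 2],
       vector [- B 1 1, - B 1 2, - A 1 1, - A 1 2],
       vector [- B 2 1, - B 2 2, - A 2 1, - A 2 2]])"

definition real_coords :: "complex^2 \<Rightarrow> real^4" where
  "real_coords v = vector [Re (v $ 1), Re (v $ 2), Im (v $ 1), Im (v $ 2)]"

(* R_mat S is the matrix of the real-linear map v \<mapsto> cnj (S v) in these coordinates. *)
lemma R_mat_mult_real_coords:
  "R_mat S *v real_coords v = real_coords (\<chi> i. cnj ((S *v v) $ i))"
proof -
  have vector_4: "(vector [w, x, y, z] :: 'b::zero^4) $ 1 = w"
    "(vector [w, x, y, z] :: 'b^4) $ 2 = x"
    "(vector [w, x, y, z] :: 'b^4) $ 3 = y"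
    "(vector [w, x, y, z] :: 'b^4) $ 4 = z" for w x y z :: "'b::zero"
    by (simp_all add: vector_def)
  show ?thesis
    by (simp add: vec_eq_iff forall_4 R_mat_def real_coords_def Let_def vector_4
        matrix_vector_mult_def sum_4 sum_2)
qed

definition type1 :: "complex^2^2 \<Rightarrow> bool" where
  "type1 S \<longleftrightarrow>
     (\<exists>u::real\<ge>0. conj_similar S (mat22 (exp (of_real u)) 0 0 (exp (- of_real u))))"

definition rot :: "real \<Rightarrow> complex^2^2" where
  "rot \<alpha> = mat22 (of_real (cos \<alpha>)) (of_real (sin \<alpha>))
                  (- of_real (sin \<alpha>)) (of_real (cos \<alpha>))"

definition antidiag :: "real \<Rightarrow> complex^2^2" where
  "antidiag \<alpha> = mat22 0 (\<i> * exp (- (\<i> * of_real \<alpha>)))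
                       (\<i> * exp (\<i> * of_real \<alpha>)) 0"

definition type2 :: "complex^2^2 \<Rightarrow> bool" where
  "type2 S \<longleftrightarrow>
     (\<exists>\<alpha>\<in>{0<..pi/2}. conj_similar S (rot \<alpha>) \<and> conj_similar (rot \<alpha>) (antidiag \<alpha>))"

definition type3 :: "complex^2^2 \<Rightarrow> bool" where
  "type3 S \<longleftrightarrow> conj_similar S (mat22 1 1 0 1)"

end

theory Submission
  imports Defs
begin

text \<open>
  The map \<open>J v = cnj (S v)\<close> is antilinear, and \<open>S\<^sub>1\<close>, \<open>S\<^sub>2\<close> are conjugate similar iff their
  antilinear maps are conjugate under \<open>GL(2,\<complex>)\<close>: equality of determinants forces the
  determinant of the intertwiner to be real, and the sign and a factor \<open>\<i>\<close> absorb its sign.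
  If some \<open>v\<close> has \<open>det (v, J v)\<close> real and nonzero, then in the basis \<open>v, J v\<close> the matrix \<open>S\<close>
  becomes \<open>(0, -1; 1, r)\<close>, where \<open>r \<ge> 0\<close> after a change of phase and
  \<open>r\<^sup>2 = \<tau> + 2\<close> for \<open>\<tau> = tr (cnj S S)\<close>. The imaginary part of \<open>det (v, J v)\<close> is a Hermitian form
  of determinant \<open>-(\<tau> + 2)/4 \<le> 0\<close>, so it has an isotropic vector; this reduces the search for \<open>v\<close>
  to upper triangular \<open>S\<close>, where it only fails if \<open>S\<close> is conjugate similar to the identity.
  Hence \<open>\<tau>\<close> together with the truth value of \<open>cnj S S = 1\<close> is a complete invariant, and both
  can be read off from the square of the real matrix. The types are
  \<open>\<tau> > 2\<close> or \<open>cnj S S = 1\<close>; \<open>\<tau> < 2\<close>; \<open>\<tau> = 2\<close> and \<open>cnj S S \<noteq> 1\<close>.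
\<close>

section \<open>Two-by-two matrices\<close>

lemma mat22_nth [simp]:
  "mat22 a b c d $ 1 $ 1 = a" "mat22 a b c d $ 1 $ 2 = b"
  "mat22 a b c d $ 2 $ 1 = c" "mat22 a b c d $ 2 $ 2 = d"
  by (simp_all add: mat22_def)

lemma mat22_eta: "A = mat22 (A $ 1 $ 1) (A $ 1 $ 2) (A $ 2 $ 1) (A $ 2 $ 2)"
  by (simp add: vec_eq_iff forall_2)

lemma mat22_cases:
  obtains a b c d where "A = mat22 a b c d"
  using mat22_eta by blast

lemma mat22_eq_iff [simp]:
  "mat22 a b c d = mat22 a' b' c' d' \<longleftrightarrow> a = a' \<and> b = b' \<and> c = c' \<and> d = d'"
  by (auto simp: vec_eq_iff forall_2)

lemma mat22_mult [simp]:
  fixes a :: "'a::comm_ring_1"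
  shows "mat22 a b c d ** mat22 a' b' c' d' =
    mat22 (a * a' + b * c') (a * b' + b * d') (c * a' + d * c') (c * b' + d * d')"
  by (simp add: vec_eq_iff forall_2 matrix_matrix_mult_def sum_2)

lemma map_matrix_mat22 [simp]:
  "map_matrix f (mat22 a b c d) = mat22 (f a) (f b) (f c) (f d)"
  by (simp add: vec_eq_iff forall_2 map_matrix_def)

lemma uminus_mat22 [simp]:
  fixes a :: "'a::comm_ring_1"
  shows "- mat22 a b c d = mat22 (- a) (- b) (- c) (- d)"
  by (simp add: vec_eq_iff forall_2)

lemma det_mat22 [simp]:
  fixes a :: "'a::comm_ring_1"
  shows "det (mat22 a b c d) = a * d - b * c"
  by (simp add: det_2)

lemma trace_mat22 [simp]:
  fixes a :: "'a::comm_ring_1"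
  shows "trace (mat22 a b c d) = a + d"
  by (simp add: trace_def sum_2)

lemma mat_eq_mat22: "(mat a :: 'a::comm_ring_1^2^2) = mat22 a 0 0 a"
  by (simp add: vec_eq_iff forall_2 mat_def)

lemma map_matrix_cnj_mult:
  fixes A :: "complex^'n^'m" and B :: "complex^'k^'n"
  shows "map_matrix cnj (A ** B) = map_matrix cnj A ** map_matrix cnj B"
  by (simp add: vec_eq_iff map_matrix_def matrix_matrix_mult_def)

lemma det_map_matrix_cnj:
  fixes A :: "complex^2^2"
  shows "det (map_matrix cnj A) = cnj (det A)"
  by (cases A rule: mat22_cases) simp

lemma map_matrix_cnj_cnj [simp]:
  fixes A :: "complex^'n^'m"
  shows "map_matrix cnj (map_matrix cnj A) = A"
  by (simp add: vec_eq_iff map_matrix_def)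

lemma invertible_matrix_inv:
  fixes P :: "'a::semiring_1^'n^'m"
  assumes "invertible P"
  shows "P ** matrix_inv P = mat 1" and "matrix_inv P ** P = mat 1"
  using someI_ex[OF assms[unfolded invertible_def]] by (simp_all add: matrix_inv_def)

lemma matrix_inv_unique:
  fixes P :: "'a::semiring_1^'n^'m"
  assumes "P ** Q = mat 1" "Q ** P = mat 1"
  shows "matrix_inv P = Q"
proof -
  have "invertible P" using assms by (auto simp: invertible_def)
  then show ?thesis
    by (metis assms(2) invertible_matrix_inv(1) matrix_mul_assoc matrix_mul_lid matrix_mul_rid)
qed

lemma det_nonzero_inverse:
  fixes T :: "'a::field^'n^'n"
  assumes "det T \<noteq> 0"
  shows "T ** matrix_inv T = mat 1" and "matrix_inv T ** T = mat 1"
  using assms by (simp_all add: invertible_det_nz invertible_matrix_inv)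

lemma map_matrix_mat_1 [simp]: "map_matrix cnj (mat 1) = mat 1"
  by (simp add: vec_eq_iff map_matrix_def mat_def)

section \<open>Conjugate similarity through intertwiners\<close>

text \<open>Frees the relation from its sign and its determinant condition: a factor i in the
  intertwiner trades one sign for the other, and a real factor rescales the determinant. Afterwards
  any invertible intertwiner will do.\<close>

lemma conj_similar_iff:
  assumes S1: "S1 \<in> SL2C" and S2: "S2 \<in> SL2C"
  shows "conj_similar S1 S2 \<longleftrightarrow> (\<exists>T. det T \<noteq> 0 \<and> S2 ** T = map_matrix cnj T ** S1)"
proof
  assume "conj_similar S1 S2"
  then obtain T where T: "det T = 1"
    and or: "S2 = map_matrix cnj T ** S1 ** matrix_inv T \<or>
             S2 = - (map_matrix cnj T ** S1 ** matrix_inv T)"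
    by (auto simp: conj_similar_def SL2C_def)
  have inv: "matrix_inv T ** T = mat 1"
    using T det_nonzero_inverse by force
  have "S2 ** T = map_matrix cnj T ** S1 \<or> - S2 ** T = map_matrix cnj T ** S1"
    using or inv by (metis add.inverse_inverse matrix_mul_assoc matrix_mul_rid)
  then show "\<exists>T. det T \<noteq> 0 \<and> S2 ** T = map_matrix cnj T ** S1"
  proof
    assume "S2 ** T = map_matrix cnj T ** S1"
    with T show ?thesis by (intro exI[of _ T]) simp
  next
    assume eq: "- S2 ** T = map_matrix cnj T ** S1"
    obtain x y z w where Tm: "T = mat22 x y z w" by (rule mat22_cases)
    obtain a b c d where Sm: "S1 = mat22 a b c d" by (rule mat22_cases)
    obtain a' b' c' d' where Sm': "S2 = mat22 a' b' c' d'" by (rule mat22_cases)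
    \<comment> \<open>Conjugation sends i to -i, so passing from T to i T absorbs the minus
      sign.\<close>
    have "S2 ** mat22 (\<i> * x) (\<i> * y) (\<i> * z) (\<i> * w)
        = map_matrix cnj (mat22 (\<i> * x) (\<i> * y) (\<i> * z) (\<i> * w)) ** S1"
      using eq unfolding Tm Sm Sm' by (auto simp: algebra_simps) (algebra+)
    moreover have "det (mat22 (\<i> * x) (\<i> * y) (\<i> * z) (\<i> * w)) = - det T"
      unfolding Tm by (simp add: algebra_simps)
    ultimately show ?thesis using T
      by (intro exI[of _ "mat22 (\<i> * x) (\<i> * y) (\<i> * z) (\<i> * w)"]) simp
  qed
next
  assume "\<exists>T. det T \<noteq> 0 \<and> S2 ** T = map_matrix cnj T ** S1"
  then obtain T where T: "det T \<noteq> 0" and eq: "S2 ** T = map_matrix cnj T ** S1"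
    by blast
  obtain x y z w where Tm: "T = mat22 x y z w" by (rule mat22_cases)
  obtain a b c d where Sm: "S1 = mat22 a b c d" by (rule mat22_cases)
  obtain a' b' c' d' where Sm': "S2 = mat22 a' b' c' d'" by (rule mat22_cases)
  have "det T = cnj (det T)"
    using arg_cong[OF eq, of det] S1 S2
    by (simp add: det_mul det_map_matrix_cnj SL2C_def)
  then obtain r where r: "det T = of_real r"
    by (metis Reals_cnj_iff Reals_cases)
  with T have "r \<noteq> 0" by auto
  \<comment> \<open>\<open>s\<close> is a square root of 1 / det T. It is real or purely imaginary,
    so conjugating it costs at most a sign.\<close>
  define s :: complex where "s = (if r > 0 then 1 else \<i>) / of_real (sqrt \<bar>r\<bar>)"
  have sqr: "complex_of_real (sqrt \<bar>r\<bar>) * complex_of_real (sqrt \<bar>r\<bar>) = of_real \<bar>r\<bar>"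
    by (metis of_real_mult real_sqrt_abs2 real_sqrt_mult_self abs_abs)
  have s2: "s * s * of_real r = 1"
    using \<open>r \<noteq> 0\<close> sqr by (auto simp: s_def field_simps)
  have s0: "s \<noteq> 0" using s2 by auto
  have cs: "cnj s = s \<or> cnj s = - s"
    by (simp add: s_def)
  define U where "U = mat22 (s * x) (s * y) (s * z) (s * w)"
  have "det U = s * s * det T"
    unfolding U_def Tm by (simp add: algebra_simps)
  then have U: "det U = 1" using s2 r by simp
  have "S2 ** U = map_matrix cnj U ** S1 \<or> S2 ** U = - (map_matrix cnj U ** S1)"
    using cs
  proof
    assume "cnj s = s"
    then show ?thesis using eq unfolding Tm Sm Sm' U_def
      by (intro disjI1, simp) (auto simp: distrib_left[symmetric] mult.left_commute[of _ s] mult.assoc)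
  next
    assume "cnj s = - s"
    then show ?thesis using eq unfolding Tm Sm Sm' U_def
      by (intro disjI2, simp) (auto simp: distrib_left[symmetric] mult.left_commute[of _ s] mult.assoc)
  qed
  moreover have "S2 ** U ** matrix_inv U = S2"
    using U det_nonzero_inverse
    by (metis matrix_mul_assoc matrix_mul_rid zero_neq_one)
  moreover have "- (map_matrix cnj U ** S1) ** matrix_inv U = - (map_matrix cnj U ** S1 ** matrix_inv U)"
    by (simp add: vec_eq_iff matrix_matrix_mult_def sum_negf)
  ultimately have "S2 = map_matrix cnj U ** S1 ** matrix_inv U \<or>
      S2 = - (map_matrix cnj U ** S1 ** matrix_inv U)"
    by metis
  with U show "conj_similar S1 S2"
    unfolding conj_similar_def SL2C_def by blast
qed

lemma conj_similar_sym:
  assumes "S1 \<in> SL2C" "S2 \<in> SL2C" "conj_similar S1 S2"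
  shows "conj_similar S2 S1"
proof -
  obtain T where T: "det T \<noteq> 0" and eq: "S2 ** T = map_matrix cnj T ** S1"
    using assms conj_similar_iff by blast
  let ?U = "matrix_inv T"
  have inv: "T ** ?U = mat 1" "?U ** T = mat 1"
    using det_nonzero_inverse[OF T] by auto
  then have "map_matrix cnj ?U ** map_matrix cnj T = mat 1"
    by (simp flip: map_matrix_cnj_mult)
  then have "S1 ** ?U = map_matrix cnj ?U ** (map_matrix cnj T ** S1) ** ?U"
    by (simp add: matrix_mul_assoc)
  also have "\<dots> = map_matrix cnj ?U ** S2 ** (T ** ?U)"
    by (simp add: eq[symmetric] matrix_mul_assoc)
  finally have "S1 ** ?U = map_matrix cnj ?U ** S2" by (simp add: inv)
  moreover have "det ?U \<noteq> 0"
    using arg_cong[OF inv(1), of det] by (auto simp: det_mul)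
  ultimately show ?thesis using assms conj_similar_iff by blast
qed

lemma conj_similar_trans:
  assumes "S1 \<in> SL2C" "S2 \<in> SL2C" "S3 \<in> SL2C" "conj_similar S1 S2" "conj_similar S2 S3"
  shows "conj_similar S1 S3"
proof -
  obtain T where T: "det T \<noteq> 0" "S2 ** T = map_matrix cnj T ** S1"
    using assms conj_similar_iff by blast
  obtain U where U: "det U \<noteq> 0" "S3 ** U = map_matrix cnj U ** S2"
    using assms conj_similar_iff by blast
  have "S3 ** (U ** T) = map_matrix cnj (U ** T) ** S1"
    by (metis T(2) U(2) map_matrix_cnj_mult matrix_mul_assoc)
  moreover have "det (U ** T) \<noteq> 0" using T U by (simp add: det_mul)
  ultimately show ?thesis using assms conj_similar_iff by blast
qed

section \<open>The real matrices\<close>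

lemma R_mat_nth:
  "R_mat S $ 1 = vector [Re (S$1$1), Re (S$1$2), - Im (S$1$1), - Im (S$1$2)]"
  "R_mat S $ 2 = vector [Re (S$2$1), Re (S$2$2), - Im (S$2$1), - Im (S$2$2)]"
  "R_mat S $ 3 = vector [- Im (S$1$1), - Im (S$1$2), - Re (S$1$1), - Re (S$1$2)]"
  "R_mat S $ 4 = vector [- Im (S$2$1), - Im (S$2$2), - Re (S$2$1), - Re (S$2$2)]"
  by (simp_all add: R_mat_def Let_def vector_def)

lemma vector_4_nth [simp]:
  "(vector [w, x, y, z] :: 'b::zero^4) $ 1 = w"
  "(vector [w, x, y, z] :: 'b^4) $ 2 = x"
  "(vector [w, x, y, z] :: 'b^4) $ 3 = y"
  "(vector [w, x, y, z] :: 'b^4) $ 4 = z"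
  by (simp_all add: vector_def)

lemma R_mat_eq_iff: "R_mat S = R_mat S' \<longleftrightarrow> S = S'"
  by (auto simp: vec_eq_iff forall_4 forall_2 R_mat_nth complex_eq_iff)

text \<open>\<open>R_mat\<close> represents antilinear maps, and a product of two of these is
  linear; only odd products are again of this form. Moving the inner conjugations outward conjugates
  the middle factor.\<close>

lemma R_mat_mult3: "R_mat A ** R_mat B ** R_mat C = R_mat (A ** map_matrix cnj B ** C)"
proof -
  obtain a b c d where A: "A = mat22 a b c d" by (rule mat22_cases)
  obtain a' b' c' d' where B: "B = mat22 a' b' c' d'" by (rule mat22_cases)
  obtain a'' b'' c'' d'' where C: "C = mat22 a'' b'' c'' d''" by (rule mat22_cases)
  show ?thesis
    unfolding A B C
    by (simp add: vec_eq_iff forall_4 R_mat_nth matrix_matrix_mult_def[of "_::real^4^4"] sum_4 algebra_simps)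
qed

lemma R_mat_1_square: "R_mat (mat 1) ** R_mat (mat 1) = mat 1"
  by (simp add: mat_eq_mat22 vec_eq_iff forall_4 R_mat_nth matrix_matrix_mult_def sum_4 mat_def)

text \<open>The square is the real form of the complex-linear map given by
  \<open>map_matrix cnj S ** S\<close>, and a real trace is twice the real part of the complex
  one.\<close>

lemma trace_R_mat_square:
  "trace (R_mat S ** R_mat S) = 2 * Re (trace (map_matrix cnj S ** S))"
proof -
  obtain a b c d where S: "S = mat22 a b c d" by (rule mat22_cases)
  show ?thesis
    unfolding S
    by (simp add: trace_def[of "_::real^4^4"] R_mat_nth matrix_matrix_mult_def[of "_::real^4^4"] sum_4 algebra_simps)
qed

lemma R_mat_square_eq_1_iff:
  "R_mat S ** R_mat S = mat 1 \<longleftrightarrow> map_matrix cnj S ** S = mat 1"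
proof -
  \<comment> \<open>A third factor, the conjugation \<open>R_mat (mat 1)\<close>, turns the square
    into an odd product.\<close>
  have "R_mat S ** R_mat S = mat 1 \<longleftrightarrow> R_mat (mat 1) ** (R_mat S ** R_mat S) = R_mat (mat 1)"
    by (metis R_mat_1_square matrix_mul_assoc matrix_mul_lid matrix_mul_rid)
  then show ?thesis
    by (simp add: matrix_mul_assoc R_mat_mult3 R_mat_eq_iff)
qed

lemma similar_matrix_conj_similar:
  assumes "S1 \<in> SL2C" "S2 \<in> SL2C" "conj_similar S1 S2"
  shows "similar_matrix (R_mat S1) (R_mat S2)"
proof -
  obtain T where T: "det T \<noteq> 0" and eq: "S2 ** T = map_matrix cnj T ** S1"
    using assms conj_similar_iff by blast
  \<comment> \<open>\<open>?J\<close> is complex conjugation, so \<open>?P\<close> and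
    \<open>?Q\<close> are the real forms of the linear maps T and its inverse.\<close>
  let ?J = "R_mat (mat 1)" and ?P = "R_mat (mat 1) ** R_mat T"
    and ?Q = "R_mat (mat 1) ** R_mat (matrix_inv T)"
  have inv: "T ** matrix_inv T = mat 1" "matrix_inv T ** T = mat 1"
    using det_nonzero_inverse[OF T] by auto
  have PQ: "(R_mat (mat 1) ** R_mat X) ** (R_mat (mat 1) ** R_mat Y) = mat 1"
    if "X ** Y = mat 1" for X Y
  proof -
    \<comment> \<open>Inserting \<open>?J ** ?J = mat 1\<close> lets the factors be grouped in
      threes.\<close>
    have "(R_mat (mat 1) ** R_mat X) ** (R_mat (mat 1) ** R_mat Y)
        = ?J ** (?J ** (?J ** R_mat X ** ?J) ** R_mat Y)"
      using R_mat_1_square by (simp add: matrix_mul_assoc)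
    also have "\<dots> = mat 1"
      by (simp add: R_mat_mult3 that R_mat_1_square)
    finally show ?thesis .
  qed
  have "?P ** ?Q = mat 1" "?Q ** ?P = mat 1"
    using PQ inv by auto
  then have P: "invertible ?P" and Q: "matrix_inv ?P = ?Q"
    by (auto simp: invertible_def intro!: matrix_inv_unique)
  have "?P ** R_mat S1 ** ?Q = (?J ** R_mat T ** R_mat S1) ** ?J ** R_mat (matrix_inv T)"
    by (simp add: matrix_mul_assoc)
  also have "\<dots> = R_mat (map_matrix cnj T ** S1 ** matrix_inv T)"
    by (simp add: R_mat_mult3)
  also have "map_matrix cnj T ** S1 ** matrix_inv T = S2 ** (T ** matrix_inv T)"
    by (simp add: eq[symmetric] matrix_mul_assoc)
  finally have "R_mat S2 = ?P ** R_mat S1 ** ?Q" by (simp add: inv)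
  with P Q show ?thesis unfolding similar_matrix_def by metis
qed

text \<open>\<open>Re\<close> loses nothing: cnj S S and its conjugate S cnj S have the same trace,
  which is therefore real.\<close>

definition ctrace :: "complex^2^2 \<Rightarrow> real" where
  "ctrace S = Re (trace (map_matrix cnj S ** S))"

lemma ctrace_mat22:
  "ctrace (mat22 a b c d) = (cmod a)\<^sup>2 + (cmod d)\<^sup>2 + 2 * Re (b * cnj c)"
  by (simp add: ctrace_def cmod_power2) (simp add: power2_eq_square algebra_simps)

lemma similar_matrix_invariants:
  assumes "similar_matrix (R_mat S1) (R_mat S2)"
  shows "ctrace S1 = ctrace S2"
    and "map_matrix cnj S1 ** S1 = mat 1 \<longleftrightarrow> map_matrix cnj S2 ** S2 = mat 1"
proof -
  obtain P where P: "invertible P" and eq: "R_mat S2 = P ** R_mat S1 ** matrix_inv P"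
    using assms by (auto simp: similar_matrix_def)
  have inv: "P ** matrix_inv P = mat 1" "matrix_inv P ** P = mat 1"
    using P by (simp_all add: invertible_matrix_inv)
  have "R_mat S2 ** R_mat S2 = P ** R_mat S1 ** (matrix_inv P ** P) ** R_mat S1 ** matrix_inv P"
    by (simp add: eq matrix_mul_assoc)
  then have sq: "R_mat S2 ** R_mat S2 = P ** (R_mat S1 ** R_mat S1) ** matrix_inv P"
    by (simp add: inv matrix_mul_assoc)
  have "trace (P ** (R_mat S1 ** R_mat S1) ** matrix_inv P)
      = trace (matrix_inv P ** (P ** (R_mat S1 ** R_mat S1)))"
    by (rule trace_mul_sym)
  then have "trace (R_mat S2 ** R_mat S2) = trace (R_mat S1 ** R_mat S1)"
    by (simp add: sq matrix_mul_assoc inv)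
  then show "ctrace S1 = ctrace S2"
    by (simp add: trace_R_mat_square ctrace_def)
  have "matrix_inv P ** (R_mat S2 ** R_mat S2) ** P
      = (matrix_inv P ** P) ** (R_mat S1 ** R_mat S1) ** (matrix_inv P ** P)"
    unfolding sq by (simp only: matrix_mul_assoc)
  then have "matrix_inv P ** (R_mat S2 ** R_mat S2) ** P = R_mat S1 ** R_mat S1"
    by (simp add: inv)
  then have "R_mat S1 ** R_mat S1 = mat 1 \<longleftrightarrow> R_mat S2 ** R_mat S2 = mat 1"
    using sq inv by auto
  then show "map_matrix cnj S1 ** S1 = mat 1 \<longleftrightarrow> map_matrix cnj S2 ** S2 = mat 1"
    by (simp add: R_mat_square_eq_1_iff)
qed


section \<open>Normal form\<close>

text \<open>The phase enters squared because a change of basis by a phase multiplies the diagonal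
  entries of an antilinear map by its square.\<close>

lemma obtain_phase:
  fixes z :: complex
  obtains t where "cmod t = 1" "t * t * z = of_real (cmod z)"
proof (cases "z = 0")
  case True
  then show ?thesis using that[of 1] by simp
next
  case False
  define t where "t = csqrt (cnj (sgn z))"
  have tt: "t * t = cnj (sgn z)"
    by (simp add: t_def flip: power2_eq_square)
  have "(cmod t)\<^sup>2 = 1"
    using tt False by (metis complex_mod_cnj norm_mult norm_sgn power2_eq_square)
  then have "cmod t = 1"
    by (simp add: power2_eq_1_iff) (smt (verit) norm_ge_zero)
  moreover have "cnj (sgn z) * z = of_real (cmod z)"
    using False complex_norm_square[of z]
    by (simp add: sgn_eq field_simps power2_eq_square)
  ultimately show ?thesis using that tt by simp
qed

text \<open>The antilinear map J v = cnj (S v) of this matrix sends e1 to e2 and e2 to - e1 + r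
  e2.\<close>

definition companion :: "real \<Rightarrow> complex^2^2" where
  "companion r = mat22 0 (- 1) 1 (of_real r)"

lemma companion_SL2C: "companion r \<in> SL2C"
  by (simp add: companion_def SL2C_def)

lemma ctrace_companion: "ctrace (companion r) = r\<^sup>2 - 2"
  by (simp add: companion_def ctrace_mat22)

lemma companion_not_real_involution:
  "map_matrix cnj (companion r) ** companion r \<noteq> mat 1"
  by (simp add: companion_def mat_eq_mat22)

lemma mat_1_SL2C: "mat 1 \<in> SL2C"
  by (simp add: SL2C_def)

lemma ctrace_cong:
  assumes "S1 \<in> SL2C" "S2 \<in> SL2C" "conj_similar S1 S2"
  shows "ctrace S1 = ctrace S2"
  using assms similar_matrix_conj_similar similar_matrix_invariants by blast

text \<open>\<open>k\<close> is the conjugate of det (v, J v) for v = (x, y). If it is real and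
  nonzero, then v, J v is a basis, and det S = 1 forces the coefficient -1 of v in J (J v). A phase
  makes the other coefficient nonnegative.\<close>

lemma conj_similar_companion:
  assumes S: "mat22 a b c d \<in> SL2C"
    and k_def: "k = cnj x * (c * x + d * y) - cnj y * (a * x + b * y)"
    and k: "Im k = 0" "k \<noteq> 0"
  shows "conj_similar (mat22 a b c d) (companion (sqrt (ctrace (mat22 a b c d) + 2)))"
proof -
  let ?S = "mat22 a b c d"
  have det: "a * d - b * c = 1" using S by (simp add: SL2C_def)
  define p q where "p = a * x + b * y" and "q = c * x + d * y"
  have k1: "k = cnj x * q - cnj y * p" by (simp add: k_def p_def q_def)
  have "cnj k = k" using k by (simp add: complex_eq_iff)
  then have k2: "k = x * cnj q - y * cnj p" by (simp add: k1)
  \<comment> \<open>Cramer's rule for the conjugate of J (J v), expanded in (cnj x, cnj y) and (p,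
    q).\<close>
  define \<beta> where "\<beta> = (cnj x * (c * cnj p + d * cnj q) - cnj y * (a * cnj p + b * cnj q)) / k"
  have \<beta>: "k * \<beta> = cnj x * (c * cnj p + d * cnj q) - cnj y * (a * cnj p + b * cnj q)"
    using k by (simp add: \<beta>_def)
  \<comment> \<open>The adjugate of S recovers v from S v = (p, q).\<close>
  have y: "q * a - p * c = y" and x: "p * d - q * b = x"
    using det unfolding p_def q_def by algebra+
  have "k * (a * cnj p + b * cnj q) = k * (- cnj x + p * \<beta>)"
    using \<beta> k1 k2 x y by algebra
  then have e1: "a * cnj p + b * cnj q = - cnj x + p * \<beta>" using k by simp
  have "k * (c * cnj p + d * cnj q) = k * (- cnj y + q * \<beta>)"
    using \<beta> k1 k2 x y by algebra
  then have e2: "c * cnj p + d * cnj q = - cnj y + q * \<beta>" using k by simp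
  \<comment> \<open>In the basis formed by \<open>v = (x, y)\<close> and \<open>J v = (cnj p, cnj q)\<close>, \<open>J (J v) = - v + cnj \<beta> * J v\<close>.\<close>
  let ?S' = "mat22 0 (- 1) 1 \<beta>"
  have S': "?S' \<in> SL2C" by (simp add: SL2C_def)
  have "?S ** mat22 x (cnj p) y (cnj q) = map_matrix cnj (mat22 x (cnj p) y (cnj q)) ** ?S'"
    using e1 e2 by (simp add: p_def[symmetric] q_def[symmetric])
  moreover have "det (mat22 x (cnj p) y (cnj q)) \<noteq> 0"
    using k k2 by (simp add: mult.commute)
  ultimately have "conj_similar ?S' ?S"
    using conj_similar_iff[OF S' S] by blast
  then have SS': "conj_similar ?S ?S'" by (rule conj_similar_sym[OF S' S])
  obtain t where t: "cmod t = 1" "t * t * \<beta> = of_real (cmod \<beta>)"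
    by (rule obtain_phase)
  have tt: "t * cnj t = 1" using t complex_norm_square[of t] by simp
  have "of_real (cmod \<beta>) * cnj t = t * \<beta>"
    unfolding t(2)[symmetric] using tt by algebra
  then have "companion (cmod \<beta>) ** mat22 t 0 0 (cnj t) = map_matrix cnj (mat22 t 0 0 (cnj t)) ** ?S'"
    by (simp add: companion_def)
  moreover have "det (mat22 t 0 0 (cnj t)) \<noteq> 0" using tt by simp
  ultimately have "conj_similar ?S' (companion (cmod \<beta>))"
    using conj_similar_iff[OF S' companion_SL2C] by blast
  then have *: "conj_similar ?S (companion (cmod \<beta>))"
    using SS' conj_similar_trans S S' companion_SL2C by blast
  \<comment> \<open>Invariance of \<open>ctrace\<close> determines the modulus of \<beta>.\<close>
  have "ctrace ?S = (cmod \<beta>)\<^sup>2 - 2"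
    using ctrace_cong[OF S companion_SL2C *] by (simp add: ctrace_companion)
  then show ?thesis using * by simp
qed

text \<open>Since bc = ad - 1, the real part of b cnj c is at least - |a||d| - 1, and what remains
  is the square of |a| - |d|.\<close>

lemma ctrace_ge:
  assumes "S \<in> SL2C"
  shows "ctrace S \<ge> - 2"
proof -
  obtain a b c d where S: "S = mat22 a b c d" by (rule mat22_cases)
  have det: "b * c = a * d - 1" using assms by (simp add: S SL2C_def) algebra
  have "- Re (b * cnj c) \<le> cmod (b * cnj c)"
    by (smt (verit) abs_Re_le_cmod)
  also have "\<dots> = cmod (a * d - 1)" by (simp add: norm_mult flip: det)
  also have "\<dots> \<le> cmod a * cmod d + 1"
    by (metis norm_mult norm_one norm_triangle_ineq4)
  finally have "- Re (b * cnj c) \<le> cmod a * cmod d + 1" .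
  moreover have "0 \<le> (cmod a - cmod d)\<^sup>2" by simp
  ultimately show ?thesis
    unfolding S ctrace_mat22 by (simp add: power2_diff)
qed

text \<open>The imaginary part is a Hermitian form in (x, y). If its coefficient \<open>Im c\<close>
  at |x|^2 vanishes, (1, 0) is isotropic; otherwise y = 1 leaves a quadratic equation, solvable
  because \<open>ctrace\<close> is at least -2.\<close>

lemma isotropic_vector:
  assumes "mat22 a b c d \<in> SL2C"
  obtains x y where "x \<noteq> 0 \<or> y \<noteq> 0"
    "Im (cnj x * (c * x + d * y) - cnj y * (a * x + b * y)) = 0"
proof (cases "Im c = 0")
  case True
  have "cnj 1 * (c * 1 + d * 0) - cnj 0 * (a * 1 + b * 0) = c" by simp
  with True show ?thesis by (intro that[of 1 0]) simp_all
next
  case False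
  define r where "r = a + cnj d"
  define R where "R = (cmod r)\<^sup>2"
  have det: "a * d - b * c = 1" using assms by (simp add: SL2C_def)
  have "ctrace (mat22 a b c d) + 2 = R + 4 * Im c * Im b"
    using arg_cong[OF det, of Re]
    by (simp add: ctrace_mat22 R_def r_def cmod_power2) (simp add: power2_eq_square algebra_simps)
  with ctrace_ge[OF assms] have disc: "R + 4 * Im c * Im b \<ge> 0" by simp
  have Im_k: "Im (cnj x * (c * x + d * 1) - cnj 1 * (a * x + b * 1))
      = Im c * (cmod x)\<^sup>2 - Im (r * x) - Im b" for x
    unfolding cmod_power2 by (simp add: r_def) (simp add: power2_eq_square algebra_simps)
  have "\<exists>x. Im c * (cmod x)\<^sup>2 - Im (r * x) - Im b = 0"
  proof (cases "R = 0")
    case True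
    with disc have "0 \<le> Im b / Im c"
      by (simp add: zero_le_divide_iff zero_le_mult_iff) linarith
    then have "Im c * (cmod (of_real (sqrt (Im b / Im c))))\<^sup>2 = Im b"
      using False by simp
    moreover have "r = 0" using True by (simp add: R_def)
    ultimately show ?thesis
      by (intro exI[of _ "of_real (sqrt (Im b / Im c))"]) simp
  next
    case R: False
    \<comment> \<open>For x = i \<xi> cnj r the product r x is purely imaginary, and the equation
      becomes a real quadratic in \<xi> with discriminant s^2.\<close>
    define s where "s = sqrt (R * (R + 4 * Im c * Im b))"
    have s: "s * s = R * (R + 4 * Im c * Im b)"
      using disc by (simp add: s_def R_def)
    define \<xi> where "\<xi> = (R + s) / (2 * Im c * R)"
    have \<xi>: "2 * Im c * R * \<xi> = R + s"
      using False R by (simp add: \<xi>_def)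
    have "4 * Im c * R * (Im c * (R * \<xi>\<^sup>2) - R * \<xi> - Im b) = 0"
      using \<xi> s by algebra
    then have eq: "Im c * (R * \<xi>\<^sup>2) - R * \<xi> - Im b = 0" using False R by simp
    let ?x = "\<i> * of_real \<xi> * cnj r"
    have "(cmod ?x)\<^sup>2 = R * \<xi>\<^sup>2"
      by (simp add: norm_mult R_def power_mult_distrib)
    moreover have "Im (r * ?x) = R * \<xi>"
      unfolding R_def cmod_power2 by (simp add: power2_eq_square algebra_simps)
    ultimately show ?thesis using eq by metis
  qed
  then obtain x where "Im c * (cmod x)\<^sup>2 - Im (r * x) - Im b = 0" ..
  then have "Im (cnj x * (c * x + d * 1) - cnj 1 * (a * x + b * 1)) = 0"
    unfolding Im_k .
  then show ?thesis using that[of x 1] by simp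
qed

text \<open>On a line of vectors where \<open>k\<close> is real, \<open>k\<close> is an affine real
  function. It vanishes identically only if |a| = 1 and b is purely imaginary, and then a basis
  fixed by J can be written down.\<close>

lemma normal_form_upper_triangular:
  assumes S: "mat22 a b 0 d \<in> SL2C"
  shows "conj_similar (mat22 a b 0 d) (mat 1) \<or>
    conj_similar (mat22 a b 0 d) (companion (sqrt (ctrace (mat22 a b 0 d) + 2)))"
proof -
  let ?S = "mat22 a b 0 d"
  have ad: "a * d = 1" using S by (simp add: SL2C_def)
  then have "a \<noteq> 0" by auto
  define \<rho> where "\<rho> = cmod a"
  have \<rho>: "\<rho> > 0" using \<open>a \<noteq> 0\<close> by (simp add: \<rho>_def)
  have a: "a * cnj (sgn a) = of_real \<rho>"
    using \<open>a \<noteq> 0\<close> complex_norm_square[of a]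
    by (simp add: sgn_eq field_simps power2_eq_square \<rho>_def)
  have "cnj a * a = of_real \<rho> * of_real \<rho>"
    using complex_norm_square[of a] by (simp add: power2_eq_square \<rho>_def mult.commute)
  then have d: "d * sgn a = of_real (1 / \<rho>)"
    using \<open>a \<noteq> 0\<close> \<rho> ad by (simp add: sgn_eq field_simps flip: \<rho>_def)
  have k: "cnj (cnj (sgn a) * \<xi>) * (0 * (cnj (sgn a) * \<xi>) + d * 1)
      - cnj 1 * (a * (cnj (sgn a) * \<xi>) + b * 1) = of_real (1 / \<rho>) * cnj \<xi> - of_real \<rho> * \<xi> - b" for \<xi>
    unfolding a[symmetric] d[symmetric] by (simp add: algebra_simps)
  \<comment> \<open>Look for the vector as \<open>(cnj (sgn a) * \<xi>, 1)\<close>; \<open>\<eta>\<close> is the value of \<open>Im \<xi>\<close> making \<open>k\<close> real.\<close>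
  define \<eta> where "\<eta> = - Im b / (1 / \<rho> + \<rho>)"
  have \<eta>: "(1 / \<rho> + \<rho>) * \<eta> = - Im b"
    using \<rho> by (simp add: \<eta>_def add_pos_pos less_imp_neq[symmetric])
  define K where "K \<xi> = complex_of_real (1 / \<rho>) * cnj (Complex \<xi> \<eta>) - of_real \<rho> * Complex \<xi> \<eta> - b" for \<xi>
  have ImK: "Im (K \<xi>) = 0" and ReK: "Re (K \<xi>) = (1 / \<rho> - \<rho>) * \<xi> - Re b" for \<xi>
    using \<eta> by (simp_all add: K_def algebra_simps)
  show ?thesis
  proof (cases "\<exists>\<xi>. K \<xi> \<noteq> 0")
    case True
    then obtain \<xi> where \<xi>: "K \<xi> \<noteq> 0" ..
    have "K \<xi> = cnj (cnj (sgn a) * Complex \<xi> \<eta>) * (0 * (cnj (sgn a) * Complex \<xi> \<eta>) + d * 1)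
      - cnj 1 * (a * (cnj (sgn a) * Complex \<xi> \<eta>) + b * 1)"
      unfolding k K_def ..
    from conj_similar_companion[OF S this ImK \<xi>] show ?thesis ..
  next
    case False
    then have 0: "Re (K 0) = 0" "Re (K 1) = 0" by auto
    then have "Re b = 0" "1 / \<rho> - \<rho> = 0" by (simp_all add: ReK)
    then have "\<rho>\<^sup>2 = 1" using \<rho> by (simp add: field_simps power2_eq_square)
    then have "\<rho> = 1" using \<rho> by (simp add: power2_eq_1_iff)
    obtain u where u: "cmod u = 1" "u * u * a = 1"
      using \<open>\<rho> = 1\<close> by (metis \<rho>_def of_real_1 obtain_phase)
    have uu: "u * cnj u = 1" using u complex_norm_square[of u] by simp
    have b: "cnj b = - b" using \<open>Re b = 0\<close> by (simp add: complex_eq_iff)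
    have e1: "a * u = cnj u" and e2: "d * cnj u = u" using u(2) uu ad by algebra+
    \<comment> \<open>The upper right entry w of the intertwiner must satisfy a w + b cnj u = cnj w;
      since b is imaginary and a u = cnj u, half of - b u works.\<close>
    have e3: "a * (- b * u / 2) + b * cnj u = cnj (- b * u / 2)"
      using e1 b by (simp add: field_simps)
    have "?S ** mat22 u (- b * u / 2) 0 (cnj u) = map_matrix cnj (mat22 u (- b * u / 2) 0 (cnj u)) ** mat 1"
      using e1 e2 e3 by simp
    moreover have "det (mat22 u (- b * u / 2) 0 (cnj u)) \<noteq> 0" using uu by simp
    ultimately have "conj_similar (mat 1) ?S"
      using conj_similar_iff[OF mat_1_SL2C S] by blast
    then show ?thesis using conj_similar_sym[OF mat_1_SL2C S] by blast
  qed
qed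

text \<open>If the isotropic v has det (v, J v) = 0, then J v is a multiple of v, and completing v
  to a basis makes S upper triangular.\<close>

lemma normal_form:
  assumes S: "S \<in> SL2C"
  shows "conj_similar S (mat 1) \<or> conj_similar S (companion (sqrt (ctrace S + 2)))"
proof -
  obtain a b c d where Sm: "S = mat22 a b c d" by (rule mat22_cases)
  obtain x y where xy: "x \<noteq> 0 \<or> y \<noteq> 0"
    and Im: "Im (cnj x * (c * x + d * y) - cnj y * (a * x + b * y)) = 0"
    using S isotropic_vector unfolding Sm by blast
  show ?thesis
  proof (cases "cnj x * (c * x + d * y) - cnj y * (a * x + b * y) = 0")
    case False
    then show ?thesis
      using conj_similar_companion[OF S[unfolded Sm] refl Im] by (simp add: Sm)
  next
    case k: True
    obtain p q where pq: "x * q - p * y = 1"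
    proof (cases "x = 0")
      case True
      with xy show ?thesis by (intro that[of 0 "- 1 / y"]) simp
    next
      case False
      then show ?thesis by (intro that[of "1 / x" 0]) simp
    qed
    then have pq': "cnj x * cnj q - cnj p * cnj y = 1"
      by (metis complex_cnj_diff complex_cnj_mult complex_cnj_one)
    let ?T = "mat22 x p y q"
    \<comment> \<open>The left factor is the inverse of the conjugate of \<open>?T\<close>; the
      lower left entry of the product is the vanishing \<open>k\<close>.\<close>
    let ?S' = "mat22 (cnj q) (- cnj p) (- cnj y) (cnj x) ** S ** ?T"
    have "map_matrix cnj ?T ** mat22 (cnj q) (- cnj p) (- cnj y) (cnj x) = mat 1"
      using pq' by (simp add: mat_eq_mat22 algebra_simps)
    then have eq: "S ** ?T = map_matrix cnj ?T ** ?S'"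
      by (metis matrix_mul_assoc matrix_mul_lid)
    have S': "?S' \<in> SL2C"
      using S pq pq' by (simp add: SL2C_def det_mul algebra_simps)
    have "det ?T \<noteq> 0" using pq by simp
    with eq have "conj_similar ?S' S"
      using conj_similar_iff[OF S' S] by blast
    then have *: "conj_similar S ?S'" by (rule conj_similar_sym[OF S' S])
    have "?S' $ 2 $ 1 = 0"
      using k unfolding Sm by (simp add: algebra_simps)
    then obtain a' b' d' where S'_eq: "?S' = mat22 a' b' 0 d'"
      by (metis mat22_eta)
    have "ctrace S = ctrace ?S'" using ctrace_cong[OF S S' *] .
    then show ?thesis
      using normal_form_upper_triangular[OF S'[unfolded S'_eq]] *
        conj_similar_trans[OF S S' mat_1_SL2C] conj_similar_trans[OF S S' companion_SL2C]
      unfolding S'_eq by metis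
  qed
qed

text \<open>The second invariant tells which of the two normal forms occurs, since it holds for the
  identity and fails for every \<open>companion\<close>; \<open>ctrace\<close> then fixes the
  parameter.\<close>

lemma conj_similar_invariants_iff:
  assumes "S1 \<in> SL2C" "S2 \<in> SL2C"
  shows "conj_similar S1 S2 \<longleftrightarrow> ctrace S1 = ctrace S2 \<and>
    (map_matrix cnj S1 ** S1 = mat 1 \<longleftrightarrow> map_matrix cnj S2 ** S2 = mat 1)"
proof
  assume "conj_similar S1 S2"
  then show "ctrace S1 = ctrace S2 \<and>
    (map_matrix cnj S1 ** S1 = mat 1 \<longleftrightarrow> map_matrix cnj S2 ** S2 = mat 1)"
    using assms similar_matrix_conj_similar similar_matrix_invariants by blast
next
  have inv: "map_matrix cnj S ** S = mat 1 \<longleftrightarrow> map_matrix cnj S' ** S' = mat 1"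
    if "S \<in> SL2C" "S' \<in> SL2C" "conj_similar S S'" for S S'
    using that similar_matrix_conj_similar similar_matrix_invariants by blast
  assume *: "ctrace S1 = ctrace S2 \<and>
    (map_matrix cnj S1 ** S1 = mat 1 \<longleftrightarrow> map_matrix cnj S2 ** S2 = mat 1)"
  define N where "N = (if map_matrix cnj S1 ** S1 = mat 1 then mat 1
      else companion (sqrt (ctrace S1 + 2)))"
  have N: "N \<in> SL2C" by (simp add: N_def mat_1_SL2C companion_SL2C)
  have nf: "conj_similar S N" if S: "S \<in> SL2C" and tr: "ctrace S = ctrace S1"
    and J: "map_matrix cnj S ** S = mat 1 \<longleftrightarrow> map_matrix cnj S1 ** S1 = mat 1" for S
  proof (cases "map_matrix cnj S ** S = mat 1")
    case True
    then have "\<not> conj_similar S (companion r)" for r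
      using inv[OF S companion_SL2C] companion_not_real_involution by blast
    with normal_form[OF S] True J show ?thesis by (simp add: N_def)
  next
    case False
    then have "\<not> conj_similar S (mat 1)"
      using inv[OF S mat_1_SL2C] by auto
    with normal_form[OF S] False J tr show ?thesis by (simp add: N_def)
  qed
  have "conj_similar S1 N" "conj_similar S2 N" using nf assms * by simp_all
  then show "conj_similar S1 S2"
    using conj_similar_trans[OF assms(1) N assms(2)] conj_similar_sym[OF assms(2) N] by blast
qed

lemma conj_similar_iff_similar_matrix:
  assumes "S1 \<in> SL2C" "S2 \<in> SL2C"
  shows "conj_similar S1 S2 \<longleftrightarrow> similar_matrix (R_mat S1) (R_mat S2)"
proof
  show "conj_similar S1 S2 \<Longrightarrow> similar_matrix (R_mat S1) (R_mat S2)"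
    by (rule similar_matrix_conj_similar[OF assms])
  assume "similar_matrix (R_mat S1) (R_mat S2)"
  from similar_matrix_invariants[OF this] show "conj_similar S1 S2"
    unfolding conj_similar_invariants_iff[OF assms] by (rule conjI)
qed

section \<open>The three types\<close>

text \<open>Hence the second invariant is false whenever \<open>ctrace\<close> differs from 2, and
  there \<open>ctrace\<close> alone decides conjugate similarity.\<close>

lemma ctrace_real_involution:
  "map_matrix cnj S ** S = mat 1 \<Longrightarrow> ctrace S = 2"
  by (simp add: ctrace_def mat_eq_mat22)

lemma rot_SL2C: "rot \<alpha> \<in> SL2C"
  by (simp add: rot_def SL2C_def flip: of_real_mult of_real_add)

lemma antidiag_SL2C: "antidiag \<alpha> \<in> SL2C"
  by (simp add: antidiag_def SL2C_def algebra_simps flip: exp_add)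

lemma ctrace_rot: "ctrace (rot \<alpha>) = 2 * cos (2 * \<alpha>)"
  by (simp add: rot_def ctrace_mat22 cos_double power2_eq_square)

lemma ctrace_antidiag: "ctrace (antidiag \<alpha>) = 2 * cos (2 * \<alpha>)"
  by (simp add: antidiag_def ctrace_mat22 cos_double power2_eq_square Re_exp Im_exp)

lemma cos_double_less_1:
  assumes "\<alpha> \<in> {0<..pi/2}"
  shows "cos (2 * \<alpha>) < 1"
  using assms cos_monotone_0_pi[of 0 "2 * \<alpha>"] by simp

lemma conj_similar_rot_antidiag:
  assumes "\<alpha> \<in> {0<..pi/2}"
  shows "conj_similar (rot \<alpha>) (antidiag \<alpha>)"
  using cos_double_less_1[OF assms] ctrace_real_involution[of "rot \<alpha>"]
    ctrace_real_involution[of "antidiag \<alpha>"]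
  by (auto simp: conj_similar_invariants_iff rot_SL2C antidiag_SL2C ctrace_rot ctrace_antidiag)

text \<open>The values 2 cos (2 \<alpha>) fill [-2, 2) on the given range, and
  \<open>ctrace_ge\<close> rules out anything smaller.\<close>

lemma type2_iff:
  assumes S: "S \<in> SL2C"
  shows "type2 S \<longleftrightarrow> ctrace S < 2"
proof
  assume "type2 S"
  then show "ctrace S < 2"
    using S cos_double_less_1
    by (auto simp: type2_def conj_similar_invariants_iff rot_SL2C ctrace_rot)
next
  assume less: "ctrace S < 2"
  define \<alpha> where "\<alpha> = arccos (ctrace S / 2) / 2"
  have cos: "2 * cos (2 * \<alpha>) = ctrace S"
    using less ctrace_ge[OF S] by (simp add: \<alpha>_def)
  have "\<alpha> \<ge> 0" "\<alpha> \<le> pi / 2"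
    using less ctrace_ge[OF S] arccos_lbound[of "ctrace S / 2"] arccos_ubound[of "ctrace S / 2"]
    by (auto simp: \<alpha>_def)
  moreover have "\<alpha> \<noteq> 0" using cos less by auto
  ultimately have \<alpha>: "\<alpha> \<in> {0<..pi/2}" by simp
  have "conj_similar S (rot \<alpha>)"
    using less cos ctrace_real_involution[of S] ctrace_real_involution[of "rot \<alpha>"]
    by (auto simp: conj_similar_invariants_iff S rot_SL2C ctrace_rot)
  then show "type2 S"
    using \<alpha> conj_similar_rot_antidiag unfolding type2_def by blast
qed

text \<open>The shear has \<open>ctrace\<close> 2, but its square has upper right entry 2.\<close>

lemma type3_iff:
  assumes S: "S \<in> SL2C"
  shows "type3 S \<longleftrightarrow> ctrace S = 2 \<and> map_matrix cnj S ** S \<noteq> mat 1"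
proof -
  have "mat22 1 1 0 1 \<in> SL2C" by (simp add: SL2C_def)
  then show ?thesis
    by (simp add: type3_def conj_similar_invariants_iff[OF S] ctrace_mat22 mat_eq_mat22)
qed

text \<open>The diagonal matrices have \<open>ctrace\<close> 2 cosh (2 u), which fills (2,
  \<infinity>) for u > 0; u = 0 gives the identity.\<close>

lemma type1_iff:
  assumes S: "S \<in> SL2C"
  shows "type1 S \<longleftrightarrow> ctrace S > 2 \<or> map_matrix cnj S ** S = mat 1"
proof -
  define D :: "real \<Rightarrow> complex^2^2" where "D u = mat22 (exp (of_real u)) 0 0 (exp (- of_real u))" for u
  have D: "D u \<in> SL2C" for u
    by (simp add: D_def SL2C_def flip: exp_add)
  have tr: "ctrace (D u) = 2 * cosh (2 * u)" for u
    by (simp add: D_def ctrace_mat22 cosh_def norm_exp_eq_Re del: exp_minus flip: exp_double)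
  have type1: "type1 S \<longleftrightarrow> (\<exists>u\<ge>0. conj_similar S (D u))"
    by (simp add: type1_def D_def)
  have inv: "map_matrix cnj (D 0) ** D 0 = mat 1"
    by (simp add: D_def mat_eq_mat22)
  show ?thesis
  proof
    assume "type1 S"
    then obtain u where u: "u \<ge> 0" "conj_similar S (D u)" using type1 by auto
    then have *: "ctrace S = 2 * cosh (2 * u)"
      "map_matrix cnj S ** S = mat 1 \<longleftrightarrow> map_matrix cnj (D u) ** D u = mat 1"
      by (simp_all add: conj_similar_invariants_iff S D tr)
    show "ctrace S > 2 \<or> map_matrix cnj S ** S = mat 1"
    proof (cases "u = 0")
      case True
      then show ?thesis using * inv by simp
    next
      case False
      then have "cosh (2 * u) > 1"
        using cosh_real_strict_mono[of 0 "2 * u"] u by simp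
      then show ?thesis using * by simp
    qed
  next
    assume *: "ctrace S > 2 \<or> map_matrix cnj S ** S = mat 1"
    show "type1 S"
    proof (cases "map_matrix cnj S ** S = mat 1")
      case True
      then have "conj_similar S (D 0)"
        using inv by (simp add: conj_similar_invariants_iff S D tr ctrace_real_involution)
      then show ?thesis using type1 by blast
    next
      case False
      with * have gt: "ctrace S > 2" by simp
      define u where "u = arcosh (ctrace S / 2) / 2"
      have u: "2 * cosh (2 * u) = ctrace S" "u \<ge> 0"
        using gt by (simp_all add: u_def)
      then have "conj_similar S (D u)"
        using gt False ctrace_real_involution[of "D u"]
        by (auto simp: conj_similar_invariants_iff S D tr)
      then show ?thesis using u type1 by blast
    qed
  qed
qed

theorem theorem2p8:
  shows "(\<forall>S1\<in>SL2C. \<forall>S2\<in>SL2C.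
            conj_similar S1 S2 \<longleftrightarrow> similar_matrix (R_mat S1) (R_mat S2))
       \<and> (\<forall>\<alpha>\<in>{0<..pi/2}. conj_similar (rot \<alpha>) (antidiag \<alpha>))
       \<and> (\<forall>S\<in>SL2C.
            (type1 S \<or> type2 S \<or> type3 S)
          \<and> \<not> (type1 S \<and> type2 S) \<and> \<not> (type1 S \<and> type3 S) \<and> \<not> (type2 S \<and> type3 S))"
proof (intro conjI ballI)
  fix S assume S: "S \<in> SL2C"
  show "type1 S \<or> type2 S \<or> type3 S" "\<not> (type1 S \<and> type2 S)"
    "\<not> (type1 S \<and> type3 S)" "\<not> (type2 S \<and> type3 S)"
    \<comment> \<open>An involution has \<open>ctrace\<close> 2, so the three characterisations
      split the real line, with the value 2 divided between types 1 and 3.\<close>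
    using ctrace_real_involution[of S]
    unfolding type1_iff[OF S] type2_iff[OF S] type3_iff[OF S] by linarith+
qed (simp_all add: conj_similar_iff_similar_matrix conj_similar_rot_antidiag)

end
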